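(* Let $N>2$ be an integer and let $a,b,c\in\mathbb{R}$ with $a=c$ and $c>0$. Let $A_h(a,b,c)$ be the $N\times N$ tridiagonal matrix with $b$ on the diagonal, $a$ on the sub-diagonal, $c$ on the super-diagonal, and zeros elsewhere. For $1\le m\le N$ define $$\lambda_m=b+2\sqrt{ac}\,\cos\!\left(\frac{m\pi}{N+1}\right),\qquad s_m=\big((s_j)_m\big)_{1\le j\le N},\quad (s_j)_m=\left(\frac{a}{c}\right)^{j-1/2}\sqrt{\frac{2}{N+1}}\,\sin\!\left(\frac{jm\pi}{N+1}\right).$$ Then for every $m\in\{1,\dots,N\}$, $A_h(a,b,c)\,s_m=\lambda_m s_m$. *)

theory Defs
  imports Complex_Main "Jordan_Normal_Form.Matrix"
begin

(* Matrix and vector entries of Jordan_Normal_Form are indexed from 0, so the mathematical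
   index j in {1..N} is stored at position j - 1. *)

definition tridiag :: "nat \<Rightarrow> real \<Rightarrow> real \<Rightarrow> real \<Rightarrow> real mat" where
  "tridiag N a b c = mat N N (\<lambda>(i, j).
     if i = j then b
     else if i = j + 1 then a
     else if j = i + 1 then c
     else 0)"

definition eigval :: "nat \<Rightarrow> real \<Rightarrow> real \<Rightarrow> real \<Rightarrow> nat \<Rightarrow> real" where
  "eigval N a b c m = b + 2 * sqrt (a * c) * cos (real m * pi / (real N + 1))"

definition eigvec_entry :: "nat \<Rightarrow> real \<Rightarrow> real \<Rightarrow> nat \<Rightarrow> nat \<Rightarrow> real" where
  "eigvec_entry N a c m j =
     (a / c) powr (real j - 1 / 2) * sqrt (2 / (real N + 1))
       * sin (real j * real m * pi / (real N + 1))"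

definition eigvec :: "nat \<Rightarrow> real \<Rightarrow> real \<Rightarrow> nat \<Rightarrow> real vec" where
  "eigvec N a c m = vec N (\<lambda>i. eigvec_entry N a c m (i + 1))"

end

theory Submission imports Defs begin

text \<open>Since \<open>a = c\<close>, the matrix is symmetric Toeplitz and the powers of \<open>a / c\<close> are all \<open>1\<close>, so the
  \<open>m\<close>-th vector samples a multiple of \<open>\<lambda>j. sin (j * \<theta>)\<close> with \<open>\<theta> = m * pi / (N + 1)\<close>. This
  function vanishes at \<open>j = 0\<close> and at \<open>j = N + 1\<close>, so the first and the last row of the matrix can
  be treated as the other rows, by extending the vector with these two zeros
  (\<open>tridiag_mult_vec_index\<close>). Every row then asks for the same three-term recurrence
  \<open>sin (x - \<theta>) + sin (x + \<theta>) = 2 * cos \<theta> * sin x\<close>, which is the addition theorem for the sine.\<close>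

text \<open>The two boundary conditions supply the neighbours that the first and the last row lack: with
  them the action of the matrix is a single three-term formula with no case distinction.\<close>

lemma tridiag_mult_vec_index:
  fixes f :: "nat \<Rightarrow> real"
  assumes "f 0 = 0" and "f (N + 1) = 0" and i: "i < N"
  shows "(tridiag N a b c *\<^sub>v vec N (\<lambda>j. f (j + 1))) $ i = a * f i + b * f (i + 1) + c * f (i + 2)"
proof -
  have "(tridiag N a b c *\<^sub>v vec N (\<lambda>j. f (j + 1))) $ i
      = (\<Sum>j<N. (if i = j then b else if i = j + 1 then a else if j = i + 1 then c else 0) * f (j + 1))"
    using i by (simp add: tridiag_def scalar_prod_def atLeast0LessThan)
  also have "\<dots> = (\<Sum>j<N. (if i = j + 1 then a * f (j + 1) else 0) + (if j = i then b * f (j + 1) else 0)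
      + (if j = i + 1 then c * f (j + 1) else 0))"
    by (rule sum.cong) auto
  also have "\<dots> = (\<Sum>j<N. if i = j + 1 then a * f (j + 1) else 0)
      + (\<Sum>j<N. if j = i then b * f (j + 1) else 0) + (\<Sum>j<N. if j = i + 1 then c * f (j + 1) else 0)"
    by (simp only: sum.distrib)
  also have "(\<Sum>j<N. if i = j + 1 then a * f (j + 1) else 0) = a * f i"
    using assms by (cases i) simp_all
  also have "(\<Sum>j<N. if j = i then b * f (j + 1) else 0) = b * f (i + 1)"
    using i by simp
  also have "(\<Sum>j<N. if j = i + 1 then c * f (j + 1) else 0) = c * f (i + 2)"
  proof (cases "i + 1 < N")
    case False
    then have "i + 2 = N + 1" using i by simp
    then have "f (i + 2) = 0" using assms(2) by simp
    then show ?thesis using False by simp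
  qed simp
  finally show ?thesis .
qed

theorem mainTheorem6:
  fixes N :: nat and a b c :: real
  assumes "N > 2" and "a = c" and "c > 0"
  shows "\<forall>m\<in>{1..N}. tridiag N a b c *\<^sub>v eigvec N a c m = eigval N a b c m \<cdot>\<^sub>v eigvec N a c m"
proof
  fix m assume "m \<in> {1..N}"
  define \<theta> where "\<theta> = real m * pi / (real N + 1)"
  define K where "K = sqrt (2 / (real N + 1))"
  define f where "f j = K * sin (real j * \<theta>)" for j :: nat
  have "real (N + 1) * \<theta> = real m * pi"
    by (simp add: \<theta>_def add.commute)
  then have f_end: "f (N + 1) = 0"
    unfolding f_def by (simp only: sin_npi mult_zero_right)
  have f_start: "f 0 = 0"
    by (simp add: f_def)
  have vec_f: "eigvec N a c m = vec N (\<lambda>j. f (j + 1))"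
    using assms by (simp add: eigvec_def eigvec_entry_def f_def K_def \<theta>_def mult.assoc)
  have lambda: "eigval N a b c m = b + 2 * c * cos \<theta>"
    using assms by (simp add: eigval_def \<theta>_def)
  have recurrence: "f i + f (i + 2) = 2 * cos \<theta> * f (i + 1)" for i
  proof -
    define x where "x = real (i + 1) * \<theta>"
    have neighbours: "real i * \<theta> = x - \<theta>" "real (i + 2) * \<theta> = x + \<theta>"
      by (simp_all add: x_def algebra_simps)
    show ?thesis
      unfolding f_def x_def [symmetric] neighbours by (simp add: sin_add sin_diff algebra_simps)
  qed
  show "tridiag N a b c *\<^sub>v eigvec N a c m = eigval N a b c m \<cdot>\<^sub>v eigvec N a c m"
  proof (rule eq_vecI)
    fix i assume "i < dim_vec (eigval N a b c m \<cdot>\<^sub>v eigvec N a c m)"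
    then have i: "i < N" by (simp add: eigvec_def)
    have "(tridiag N a b c *\<^sub>v eigvec N a c m) $ i = c * (f i + f (i + 2)) + b * f (i + 1)"
      unfolding vec_f tridiag_mult_vec_index [where f = f, OF f_start f_end i]
      using assms by (simp add: algebra_simps)
    also have "\<dots> = eigval N a b c m * f (i + 1)"
      by (simp only: recurrence lambda) (simp add: algebra_simps)
    finally show "(tridiag N a b c *\<^sub>v eigvec N a c m) $ i
        = (eigval N a b c m \<cdot>\<^sub>v eigvec N a c m) $ i"
      using i by (simp add: vec_f)
  qed (simp add: tridiag_def eigvec_def)
qed

end
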